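(* If jobs have agreeable deadlines, then there is a deterministic online algorithm for online unit-length busy time scheduling on heterogeneous machines that is 2-competitive (its cost is at most $2\cdot\mathrm{cost}(\mathsf{OPT})$ on every such instance) and has running time $O(nK+n\log n)$, where $n$ is the total number of jobs and $K$ is the number of distinct machine types.
   Context: Online unit-length busy time scheduling on heterogeneous machines: there are $K$ machine types, with an unlimited number of machines of each type; a machine of type $k$ has capacity $B_k\in\mathbb{Z}_{\ge 1}$ and cost $c_k\ge 1$ per time step in which it executes at least one job. A set $J$ of $n$ unit-length jobs is given online: job $j$ has an integer release time $r_j$ and an integer deadline $d_j\ge r_j$, both revealed at time $r_j$. A batch $X$ consists of a set of jobs $J(X)$, a type $t(X)$ and an integer execution time $\tau(X)$; a feasible schedule is a partition of $J$ into batches with $|J(X)|\le B_{t(X)}$ and $r_j\le\tau(X)\le d_j$ for all $j\in J(X)$, with cost $\sum_X c_{t(X)}$. $\mathsf{OPT}$ is a minimum-cost feasible schedule computed offline. An online algorithm, at each integer time $\tau$ and knowing only the jobs released up to $\tau$, irrevocably decides which batches to execute at time $\tau$. Jobs have agreeable deadlines if for any two jobs $j,j'$ with $r_j<r_{j'}$ we have $d_j\le d_{j'}$. *)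

theory Defs
  imports Complex_Main "HOL-Library.Disjoint_Sets"
begin

section \<open>Busy time scheduling of unit-length jobs on heterogeneous machines\<close>

text \<open>
  Machine types are numbered \<open>0, \<dots>, ntypes - 1\<close>; jobs are numbered \<open>0, \<dots>, njobs - 1\<close> in the
  order in which they are revealed, with arbitrary order among jobs of equal release time.
\<close>

record problem =
  ntypes :: nat
  capacity :: "nat \<Rightarrow> nat"
  price :: "nat \<Rightarrow> real"
  njobs :: nat
  release :: "nat \<Rightarrow> int"
  deadline :: "nat \<Rightarrow> int"

definition wf_problem :: "problem \<Rightarrow> bool" where
  "wf_problem I \<longleftrightarrow>
     1 \<le> ntypes I \<and>
     (\<forall>k<ntypes I. 1 \<le> capacity I k \<and> 1 \<le> price I k) \<and>
     (\<forall>j<njobs I. release I j \<le> deadline I j) \<and>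
     (\<forall>j<njobs I. \<forall>i\<le>j. release I i \<le> release I j)"

definition agreeable :: "problem \<Rightarrow> bool" where
  "agreeable I \<longleftrightarrow>
     (\<forall>i<njobs I. \<forall>j<njobs I. release I i < release I j \<longrightarrow> deadline I i \<le> deadline I j)"

record batch =
  bjobs :: "nat set"
  btype :: nat
  btime :: int

text \<open>
  Distinctness of the job sets matters: it excludes listing one batch twice, so that the
  batches are exactly the blocks of the partition.
\<close>

definition feasible :: "problem \<Rightarrow> batch list \<Rightarrow> bool" where
  "feasible I S \<longleftrightarrow>
     distinct (map bjobs S) \<and> partition_on {..<njobs I} (bjobs ` set S) \<and>
     (\<forall>X\<in>set S. btype X < ntypes I \<and> card (bjobs X) \<le> capacity I (btype X) \<and>
        (\<forall>j\<in>bjobs X. release I j \<le> btime X \<and> btime X \<le> deadline I j))"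

definition cost :: "problem \<Rightarrow> batch list \<Rightarrow> real" where
  "cost I S = (\<Sum>X\<leftarrow>S. price I (btype X))"

definition optimal :: "problem \<Rightarrow> batch list \<Rightarrow> bool" where
  "optimal I S \<longleftrightarrow> feasible I S \<and> (\<forall>S'. feasible I S' \<longrightarrow> cost I S \<le> cost I S')"


section \<open>Deterministic online algorithms as event-driven random access programs\<close>

text \<open>
  An online algorithm is one fixed program for a unit-cost random access machine. The machine
  has integer and real cells (prices are real numbers); its arithmetic is addition, subtraction,
  halving of integers, comparison and the embedding of the integers into the reals. It has no
  multiplication and no rounding of reals, so long computations cannot be packed into a few
  operations on huge numbers.

  The program is a handler that is invoked whenever jobs are released and whenever an alarm it
  has set goes off; its memory persists between invocations. An algorithm that acts at every
  integer time sets the alarm to the next time step; invoking it on events only keeps the running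
  time independent of the length of idle periods.
\<close>

datatype iexp =
    Lit int
  | Cell string iexp
  | Plus iexp iexp
  | Minus iexp iexp
  | Half iexp
  | Clock
  | Num_types
  | Num_released
  | Capacity iexp
  | Release iexp
  | Deadline iexp

datatype rexp =
    Of_int iexp
  | RCell string iexp
  | RPlus rexp rexp
  | RMinus rexp rexp
  | Price iexp

datatype bexp =
    Le iexp iexp
  | RLe rexp rexp
  | Neg bexp
  | Conj bexp bexp

text \<open>
  \<open>Open k\<close> starts a new batch of type \<open>k\<close> executed at the current time, \<open>Put j\<close> adds job \<open>j\<close> to
  the batch opened last, and \<open>Alarm t\<close> sets the alarm to time \<open>t\<close>.
\<close>

datatype com =
    Skip
  | Assign string iexp iexp
  | RAssign string iexp rexp
  | Open iexp
  | Put iexp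
  | Alarm iexp
  | Seq com com
  | If bexp com com
  | While bexp com

record memory =
  icells :: "string \<Rightarrow> int \<Rightarrow> int"
  rcells :: "string \<Rightarrow> int \<Rightarrow> real"

record state = memory +
  emitted :: "batch list"
  alarm :: "int option"

text \<open>
  What the program can see at time \<open>t\<close>: all machine types, but only the jobs released up to \<open>t\<close>.
  For well-formed problems these are the jobs below the cardinality in the definition. Entries
  that are not visible read as zero.
\<close>

definition revealed :: "problem \<Rightarrow> int \<Rightarrow> problem" where
  "revealed I t = (let m = card {j. j < njobs I \<and> release I j \<le> t} in
     \<lparr>ntypes = ntypes I,
      capacity = (\<lambda>k. if k < ntypes I then capacity I k else 0),
      price = (\<lambda>k. if k < ntypes I then price I k else 0),
      njobs = m,
      release = (\<lambda>j. if j < m then release I j else 0),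
      deadline = (\<lambda>j. if j < m then deadline I j else 0)\<rparr>)"

text \<open>
  In the semantics, \<open>V\<close> is the visible part of the problem and \<open>t\<close> the current time. Indices of
  types and jobs are truncated by \<^const>\<open>nat\<close>; indices of memory cells are arbitrary integers.
\<close>

primrec ieval :: "problem \<Rightarrow> int \<Rightarrow> iexp \<Rightarrow> state \<Rightarrow> int" where
  "ieval V t (Lit i) s = i"
| "ieval V t (Cell x e) s = icells s x (ieval V t e s)"
| "ieval V t (Plus e f) s = ieval V t e s + ieval V t f s"
| "ieval V t (Minus e f) s = ieval V t e s - ieval V t f s"
| "ieval V t (Half e) s = ieval V t e s div 2"
| "ieval V t Clock s = t"
| "ieval V t Num_types s = int (ntypes V)"
| "ieval V t Num_released s = int (njobs V)"
| "ieval V t (Capacity e) s = int (capacity V (nat (ieval V t e s)))"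
| "ieval V t (Release e) s = release V (nat (ieval V t e s))"
| "ieval V t (Deadline e) s = deadline V (nat (ieval V t e s))"

primrec reval :: "problem \<Rightarrow> int \<Rightarrow> rexp \<Rightarrow> state \<Rightarrow> real" where
  "reval V t (Of_int e) s = real_of_int (ieval V t e s)"
| "reval V t (RCell x e) s = rcells s x (ieval V t e s)"
| "reval V t (RPlus e f) s = reval V t e s + reval V t f s"
| "reval V t (RMinus e f) s = reval V t e s - reval V t f s"
| "reval V t (Price e) s = price V (nat (ieval V t e s))"

primrec beval :: "problem \<Rightarrow> int \<Rightarrow> bexp \<Rightarrow> state \<Rightarrow> bool" where
  "beval V t (Le e f) s \<longleftrightarrow> ieval V t e s \<le> ieval V t f s"
| "beval V t (RLe e f) s \<longleftrightarrow> reval V t e s \<le> reval V t f s"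
| "beval V t (Neg b) s \<longleftrightarrow> \<not> beval V t b s"
| "beval V t (Conj b c) s \<longleftrightarrow> beval V t b s \<and> beval V t c s"

fun put_job :: "nat \<Rightarrow> batch list \<Rightarrow> batch list" where
  "put_job j [] = []"
| "put_job j (X # S) = X\<lparr>bjobs := insert j (bjobs X)\<rparr> # S"

text \<open>
  \<open>exec V t c s k s'\<close>: started in \<open>s\<close>, the command \<open>c\<close> terminates in \<open>s'\<close> after \<open>k\<close> steps. Every
  elementary command and every test counts as one step; expressions are part of the fixed program,
  so evaluating one takes a bounded number of machine operations.
\<close>

inductive exec :: "problem \<Rightarrow> int \<Rightarrow> com \<Rightarrow> state \<Rightarrow> nat \<Rightarrow> state \<Rightarrow> bool" for V t where
  Skip: "exec V t Skip s 1 s"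
| Assign: "exec V t (Assign x e f) s 1
    (s\<lparr>icells := (icells s)(x := (icells s x)(ieval V t e s := ieval V t f s))\<rparr>)"
| RAssign: "exec V t (RAssign x e f) s 1
    (s\<lparr>rcells := (rcells s)(x := (rcells s x)(ieval V t e s := reval V t f s))\<rparr>)"
| Open: "exec V t (Open e) s 1
    (s\<lparr>emitted := \<lparr>bjobs = {}, btype = nat (ieval V t e s), btime = t\<rparr> # emitted s\<rparr>)"
| Put: "exec V t (Put e) s 1
    (s\<lparr>emitted := put_job (nat (ieval V t e s)) (emitted s)\<rparr>)"
| Alarm: "exec V t (Alarm e) s 1 (s\<lparr>alarm := Some (ieval V t e s)\<rparr>)"
| Seq: "exec V t c s k s' \<Longrightarrow> exec V t d s' l s'' \<Longrightarrow> exec V t (Seq c d) s (k + l) s''"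
| If_True: "beval V t b s \<Longrightarrow> exec V t c s k s' \<Longrightarrow> exec V t (If b c d) s (1 + k) s'"
| If_False: "\<not> beval V t b s \<Longrightarrow> exec V t d s k s' \<Longrightarrow> exec V t (If b c d) s (1 + k) s'"
| While_False: "\<not> beval V t b s \<Longrightarrow> exec V t (While b c) s 1 s"
| While_True: "beval V t b s \<Longrightarrow> exec V t c s k s' \<Longrightarrow> exec V t (While b c) s' l s'' \<Longrightarrow>
    exec V t (While b c) s (1 + k + l) s''"

definition events_after :: "problem \<Rightarrow> int \<Rightarrow> int option \<Rightarrow> int set" where
  "events_after I t a = {u. t < u \<and> (u \<in> release I ` {..<njobs I} \<or> a = Some u)}"

text \<open>
  \<open>run P I t m a S k\<close>: after time \<open>t\<close>, with memory contents \<open>m\<close> and pending alarm \<open>a\<close>, program \<open>P\<close>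
  executes the batches \<open>S\<close> in \<open>k\<close> steps. Each invocation starts with an empty list of emitted
  batches, so batches executed earlier cannot be changed, and with no alarm set. The run is over
  when no event is left; the program itself is not told this.
\<close>

inductive run ::
  "com \<Rightarrow> problem \<Rightarrow> int \<Rightarrow> memory \<Rightarrow> int option \<Rightarrow> batch list \<Rightarrow> nat \<Rightarrow> bool" for P I where
  Done: "events_after I t a = {} \<Longrightarrow> run P I t m a [] 0"
| Event: "events_after I t a \<noteq> {} \<Longrightarrow> u = Min (events_after I t a) \<Longrightarrow>
    exec (revealed I u) u P (memory.extend m \<lparr>emitted = [], alarm = None\<rparr>) k s \<Longrightarrow>
    run P I u (memory.truncate s) (alarm s) S l \<Longrightarrow>
    run P I t m a (emitted s @ S) (k + l)"

definition run_online :: "com \<Rightarrow> problem \<Rightarrow> batch list \<Rightarrow> nat \<Rightarrow> bool" where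
  "run_online P I S k \<longleftrightarrow>
     run P I (release I 0 - 1) \<lparr>icells = (\<lambda>_ _. 0), rcells = (\<lambda>_ _. 0)\<rparr> None S k"

definition competitive_on :: "problem set \<Rightarrow> real \<Rightarrow> com \<Rightarrow> bool" where
  "competitive_on \<I> \<rho> P \<longleftrightarrow>
     (\<forall>I\<in>\<I>. \<exists>S k. run_online P I S k \<and> feasible I S \<and>
        (\<forall>OPT. optimal I OPT \<longrightarrow> cost I S \<le> \<rho> * cost I OPT))"

text \<open>
  The empty job set is excluded since \<open>n K + n log n\<close> vanishes there. For \<open>n, K \<ge> 1\<close> the expression
  is at least one, so a single constant for all values is the usual meaning of the O-notation.
\<close>

definition runs_in_O_on :: "problem set \<Rightarrow> (nat \<Rightarrow> nat \<Rightarrow> real) \<Rightarrow> com \<Rightarrow> bool" where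
  "runs_in_O_on \<I> f P \<longleftrightarrow>
     (\<exists>C. \<forall>I\<in>\<I>. \<forall>S k. njobs I \<ge> 1 \<longrightarrow> run_online P I S k \<longrightarrow>
        real k \<le> C * f (njobs I) (ntypes I))"


section \<open>Sanity checks of the model\<close>

lemma exec_deterministic:
  "exec V t c s k s' \<Longrightarrow> exec V t c s l s'' \<Longrightarrow> k = l \<and> s' = s''"
proof (induction arbitrary: l s'' rule: exec.induct)
  case (Seq c s k s' d l s'')
  from Seq.prems Seq.IH show ?case by (cases rule: exec.cases) blast+
next
  case (While_True b s c k s' l s'')
  from While_True.prems While_True.IH While_True.hyps show ?case
    by (cases rule: exec.cases) blast+
qed (erule exec.cases; auto)+

lemma run_deterministic:
  "run P I t m a S k \<Longrightarrow> run P I t m a S' k' \<Longrightarrow> S = S' \<and> k = k'"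
proof (induction arbitrary: S' k' rule: run.induct)
  case (Done t a m)
  then show ?case by (auto elim: run.cases)
next
  case (Event t a u m k s S l)
  from Event.prems show ?case
  proof (cases rule: run.cases)
    case Done
    with Event.hyps show ?thesis by simp
  next
    case E: (Event u2 k2 s2 S2 l2)
    have "u2 = u" using E Event.hyps by simp
    with E Event.hyps exec_deterministic have "k2 = k \<and> s2 = s" by blast
    with E \<open>u2 = u\<close> Event.IH show ?thesis by blast
  qed
qed

lemma optimal_exists:
  assumes "wf_problem I"
  shows "\<exists>S. optimal I S"
proof -
  let ?n = "njobs I"
  let ?R = "release I ` {..<?n}" and ?D = "deadline I ` {..<?n}"
  let ?mk = "\<lambda>(A, k, t). \<lparr>bjobs = A, btype = k, btime = t\<rparr>"
  let ?U = "?mk ` (Pow {..<?n} \<times> {..<ntypes I} \<times> {Min ?R..Max ?D})"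
  have sub: "set S \<subseteq> ?U \<and> distinct S" if S: "feasible I S" for S
  proof
    show "distinct S" using S by (auto simp: feasible_def distinct_map)
    show "set S \<subseteq> ?U"
    proof
      fix X assume X: "X \<in> set S"
      have part: "partition_on {..<?n} (bjobs ` set S)" using S by (simp add: feasible_def)
      have ne: "bjobs X \<noteq> {}" and le: "bjobs X \<subseteq> {..<?n}"
        using part X by (auto simp: partition_on_def)
      then obtain j where j: "j \<in> bjobs X" "j < ?n" by auto
      have b: "release I j \<le> btime X" "btime X \<le> deadline I j" "btype X < ntypes I"
        using S X j by (auto simp: feasible_def)
      have "Min ?R \<le> release I j" "deadline I j \<le> Max ?D" using j by auto
      with b le have "(bjobs X, btype X, btime X)
          \<in> Pow {..<?n} \<times> {..<ntypes I} \<times> {Min ?R..Max ?D}" by auto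
      moreover have "X = ?mk (bjobs X, btype X, btime X)" by simp
      ultimately show "X \<in> ?U" by (rule rev_image_eqI)
    qed
  qed
  have "finite ?U" by simp
  then have "finite {S. set S \<subseteq> ?U \<and> distinct S}" by (rule finite_subset_distinct)
  then have fin: "finite {S. feasible I S}" by (rule rev_finite_subset) (use sub in auto)
  let ?S = "map (\<lambda>j. \<lparr>bjobs = {j}, btype = 0, btime = release I j\<rparr>) [0..<?n]"
  have "bjobs ` set ?S = (\<lambda>j. {j}) ` {..<?n}" by (auto simp: image_iff)
  moreover have "partition_on {..<?n} ((\<lambda>j. {j}) ` {..<?n})"
    by (auto simp: partition_on_def disjoint_def)
  ultimately have "feasible I ?S"
    using assms by (auto simp: feasible_def wf_problem_def distinct_map inj_on_def comp_def Suc_le_eq)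
  with fin show ?thesis
    using ex_min_if_finite[of "cost I ` {S. feasible I S}"]
    by (force simp: optimal_def not_less)
qed

lemma exec_btime:
  "exec V t c s k s' \<Longrightarrow> \<forall>X\<in>set (emitted s). btime X = t \<Longrightarrow> \<forall>X\<in>set (emitted s'). btime X = t"
proof (induction rule: exec.induct)
  case (Put e s)
  then show ?case by (cases "emitted s") auto
qed auto

lemma finite_events_after: "finite (events_after I t a)"
proof (rule finite_subset)
  show "events_after I t a \<subseteq> release I ` {..<njobs I} \<union> set_option a"
    by (auto simp: events_after_def)
qed simp

lemma next_event:
  assumes "events_after I t a \<noteq> {}" "u = Min (events_after I t a)"
  shows "u \<in> events_after I t a" "v \<in> events_after I t a \<Longrightarrow> u \<le> v" "t < u"
proof -
  show u: "u \<in> events_after I t a"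
    unfolding assms(2) by (rule Min_in[OF finite_events_after assms(1)])
  show "u \<le> v" if "v \<in> events_after I t a"
    unfolding assms(2) by (rule Min_le[OF finite_events_after that])
  show "t < u" using u by (simp add: events_after_def)
qed

lemma run_btime: "run P I t m a S k \<Longrightarrow> \<forall>X\<in>set S. t < btime X"
proof (induction rule: run.induct)
  case (Event t a u m k s S l)
  have "t < u" using next_event[OF Event.hyps(1,2)] by simp
  moreover have "\<forall>X\<in>set (emitted s). btime X = u"
    using exec_btime[OF Event.hyps(3)] by (simp add: memory.extend_def)
  ultimately show ?case using Event.IH by fastforce
qed simp

lemma revealed_simps [simp]:
  "ntypes (revealed I t) = ntypes I"
  "capacity (revealed I t) = (\<lambda>k. if k < ntypes I then capacity I k else 0)"
  "price (revealed I t) = (\<lambda>k. if k < ntypes I then price I k else 0)"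
  "release (revealed I t) = (\<lambda>j. if j < njobs (revealed I t) then release I j else 0)"
  "deadline (revealed I t) = (\<lambda>j. if j < njobs (revealed I t) then deadline I j else 0)"
  by (simp_all add: revealed_def Let_def)

lemma njobs_revealed: "njobs (revealed I t) = card {j. j < njobs I \<and> release I j \<le> t}"
  by (simp add: revealed_def Let_def)

lemma released_initial:
  assumes "wf_problem I"
  shows "{j. j < njobs I \<and> release I j \<le> t} = {..<njobs (revealed I t)}"
proof -
  let ?A = "{j. j < njobs I \<and> release I j \<le> t}"
  have down: "i \<in> ?A" if "j \<in> ?A" "i \<le> j" for i j
  proof -
    have "release I i \<le> release I j" using assms that by (simp add: wf_problem_def)
    with that show ?thesis by simp
  qed
  have fin: "finite ?A" by simp
  have "\<exists>m. ?A = {..<m}"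
  proof (cases "?A = {}")
    case False
    then have "Max ?A \<in> ?A" using fin Max_in by blast
    then have "?A = {..<Suc (Max ?A)}" 
      using Max_ge[OF fin] down[of "Max ?A"] unfolding lessThan_Suc_atMost atMost_def by blast
    then show ?thesis by blast
  qed (auto intro: exI[of _ 0])
  then obtain m where m: "?A = {..<m}" by blast
  then have "card ?A = m" by simp
  with m show ?thesis by (simp add: njobs_revealed)
qed

lemma revealed_eq_iff:
  assumes "wf_problem I" "wf_problem I'" "revealed I t = revealed I' t" "u \<le> t"
  shows "{j. j < njobs I \<and> release I j \<le> u} = {j. j < njobs I' \<and> release I' j \<le> u}"
    and "j < njobs I \<Longrightarrow> release I j \<le> u \<Longrightarrow> release I' j = release I j \<and> deadline I' j = deadline I j"
proof -
  let ?m = "njobs (revealed I t)"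
  have A: "{j. j < njobs I \<and> release I j \<le> t} = {..<?m}"
    and A': "{j. j < njobs I' \<and> release I' j \<le> t} = {..<?m}"
    using released_initial assms by metis+
  have eq: "release I' j = release I j \<and> deadline I' j = deadline I j" if "j < ?m" for j
  proof -
    have "release (revealed I t) j = release (revealed I' t) j"
      "deadline (revealed I t) j = deadline (revealed I' t) j" using assms by simp_all
    moreover have "j < njobs (revealed I' t)" using that assms by simp
    ultimately show ?thesis using that by simp
  qed
  have B: "{j. j < njobs I \<and> release I j \<le> u} = {j. j < ?m \<and> release I j \<le> u}"
  proof (intro Collect_cong)
    fix j
    have "j < ?m \<longleftrightarrow> j < njobs I \<and> release I j \<le> t" using A by blast
    with \<open>u \<le> t\<close> show "j < njobs I \<and> release I j \<le> u \<longleftrightarrow> j < ?m \<and> release I j \<le> u" by linarith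
  qed
  have B': "{j. j < njobs I' \<and> release I' j \<le> u} = {j. j < ?m \<and> release I' j \<le> u}"
  proof (intro Collect_cong)
    fix j
    have "j < ?m \<longleftrightarrow> j < njobs I' \<and> release I' j \<le> t" using A' by blast
    with \<open>u \<le> t\<close> show "j < njobs I' \<and> release I' j \<le> u \<longleftrightarrow> j < ?m \<and> release I' j \<le> u" by linarith
  qed
  show "{j. j < njobs I \<and> release I j \<le> u} = {j. j < njobs I' \<and> release I' j \<le> u}"
    unfolding B B' using eq by auto
  show "release I' j = release I j \<and> deadline I' j = deadline I j"
    if "j < njobs I" "release I j \<le> u"
  proof -
    have "j < ?m" using that B by blast
    then show ?thesis by (rule eq)
  qed
qed

lemma revealed_mono:
  assumes "wf_problem I" "wf_problem I'" "revealed I t = revealed I' t" "u \<le> t"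
  shows "revealed I u = revealed I' u"
proof -
  note eq = revealed_eq_iff[OF assms]
  have m: "njobs (revealed I' u) = njobs (revealed I u)"
    using eq(1) by (simp add: njobs_revealed)
  have lt: "j < njobs I \<and> release I j \<le> u" if "j < njobs (revealed I u)" for j
    using that released_initial[OF assms(1), of u] by blast
  have types: "ntypes (revealed I t) = ntypes (revealed I' t)"
    "capacity (revealed I t) = capacity (revealed I' t)"
    "price (revealed I t) = price (revealed I' t)" using assms(3) by simp_all
  show ?thesis
  proof (rule problem.equality)
    show "release (revealed I u) = release (revealed I' u)"
      "deadline (revealed I u) = deadline (revealed I' u)"
      using m lt eq(2) by (simp_all add: fun_eq_iff)
  qed (use m types in simp_all)
qed

text \<open>
  The schedule up to time \<open>\<tau>\<close> depends only on the machine types and the jobs released up to \<open>\<tau>\<close>.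
\<close>

theorem run_online_nonanticipating:
  assumes wf: "wf_problem I" "wf_problem I'" and eq: "revealed I \<tau> = revealed I' \<tau>"
    and runs: "run_online P I S k" "run_online P I' S' k'"
  shows "filter (\<lambda>X. btime X \<le> \<tau>) S = filter (\<lambda>X. btime X \<le> \<tau>) S'"
proof -
  have events: "u \<in> events_after I t a \<longleftrightarrow> u \<in> events_after I' t a" if "u \<le> \<tau>" for u t a
  proof -
    note e = revealed_eq_iff[OF wf eq that]
    have "u \<in> release I ` {..<njobs I} \<longleftrightarrow> u \<in> release I' ` {..<njobs I'}"
    proof -
      have "u \<in> release I ` {..<njobs I} \<longleftrightarrow> u \<in> release I ` {j. j < njobs I \<and> release I j \<le> u}"
        by auto
      also have "release I ` {j. j < njobs I \<and> release I j \<le> u}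
          = release I' ` {j. j < njobs I' \<and> release I' j \<le> u}"
        unfolding e(1)[symmetric] by (rule image_cong) (use e(2) in auto)
      also have "u \<in> \<dots> \<longleftrightarrow> u \<in> release I' ` {..<njobs I'}" by auto
      finally show ?thesis .
    qed
    then show ?thesis by (simp add: events_after_def)
  qed
  have late: "filter (\<lambda>X. btime X \<le> \<tau>) Q = []"
    if "run P L t m a Q l" "\<forall>u\<in>events_after L t a. \<tau> < u" for P L t m a Q l
    using that(1)
  proof (cases rule: run.cases)
    case (Event u k s S l)
    have "\<tau> < u" using that(2) next_event(1)[OF Event(3,4)] by blast
    moreover have "\<forall>X\<in>set (emitted s). btime X = u"
      using exec_btime[OF Event(5)] by (simp add: memory.extend_def)
    moreover have "\<forall>X\<in>set S. u < btime X" using Event(6) run_btime by blast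
    ultimately show ?thesis using Event(1) by (fastforce simp: filter_empty_conv)
  qed simp
  have main: "filter (\<lambda>X. btime X \<le> \<tau>) S = filter (\<lambda>X. btime X \<le> \<tau>) S'"
    if "run P I t m a S k" "run P I' t m a S' k'" for t m a S k S' k'
    using that
  proof (induction arbitrary: S' k' rule: run.induct)
    case (Done t a m)
    then have "\<forall>u\<in>events_after I' t a. \<tau> < u" using events by (metis empty_iff not_le)
    then show ?case using late Done.prems by simp
  next
    case (Event t a u m k s S l)
    have u: "u \<in> events_after I t a" "\<forall>v\<in>events_after I t a. u \<le> v"
      using next_event[OF Event.hyps(1,2)] by simp_all
    show ?case
    proof (cases "u \<le> \<tau>")
      case False
      then have "\<forall>v\<in>events_after I t a. \<tau> < v" using u by force
      moreover from this have "\<forall>v\<in>events_after I' t a. \<tau> < v" using events by (meson not_le)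
      moreover have "run P I t m a (emitted s @ S) (k + l)"
        using Event.hyps by (rule run.Event)
      ultimately show ?thesis using late Event.prems by metis
    next
      case True
      have u': "u \<in> events_after I' t a" using events True u by blast
      have "u \<le> v" if "v \<in> events_after I' t a" for v
        using that u events True by (meson linear order_trans)
      then have min: "Min (events_after I' t a) = u"
        using u' by (intro Min_eqI finite_events_after) auto
      have rev: "revealed I' u = revealed I u"
        using revealed_mono[OF wf eq True] by simp
      from Event.prems show ?thesis
      proof (cases rule: run.cases)
        case Done
        with u' show ?thesis by simp
      next
        case E: (Event u2 k2 s2 S2 l2)
        have "u2 = u" using E min by simp
        then have "s2 = s" using E Event.hyps rev exec_deterministic by metis
        then show ?thesis using E Event.IH \<open>u2 = u\<close> by auto
      qed
    qed
  qed
  show ?thesis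
  proof (cases "0 < njobs I \<and> release I 0 \<le> \<tau>")
    case True
    then have "release I' 0 = release I 0" using revealed_eq_iff(2)[OF wf eq] by blast
    then show ?thesis using main runs by (simp add: run_online_def)
  next
    case False
    have none: "\<tau> < u" if "u \<in> events_after L t None" "wf_problem L"
      "\<not> (0 < njobs L \<and> release L 0 \<le> \<tau>)" for L u t
      using that unfolding events_after_def wf_problem_def by fastforce
    have False': "\<not> (0 < njobs I' \<and> release I' 0 \<le> \<tau>)"
      using False revealed_eq_iff(1)[OF wf eq order_refl] by blast
    have "filter (\<lambda>X. btime X \<le> \<tau>) S = []"
      using runs(1) none[OF _ wf(1) False] unfolding run_online_def by (blast intro: late)
    moreover have "filter (\<lambda>X. btime X \<le> \<tau>) S' = []"
      using runs(2) none[OF _ wf(2) False'] unfolding run_online_def by (blast intro: late)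
    ultimately show ?thesis by simp
  qed
qed

end

theory Submission
  imports Defs
begin

text \<open>
  Whenever the earliest deadline among the pending jobs is reached, execute all pending jobs at
  once, by a cheapest collection of batches (a covering knapsack problem). Let \<open>t\<^sub>1 < t\<^sub>2 < \<dots>\<close> be the
  times at which this happens. A job executed at \<open>t\<^sub>i\<close> is released after \<open>t\<^sub>i\<^sub>-\<^sub>1\<close>, and some job with
  deadline \<open>t\<^sub>i\<^sub>+\<^sub>1\<close> is released after \<open>t\<^sub>i\<close>; as deadlines are agreeable, every feasible schedule
  executes the jobs of round \<open>i\<close> within \<open>t\<^sub>i\<^sub>-\<^sub>1 < \<tau> \<le> t\<^sub>i\<^sub>+\<^sub>1\<close>, and its batches in that window form a
  cover. Each batch is counted for at most two rounds.

  The knapsack table is indexed by the number of jobs only, so it persists between rounds and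
  grows by one entry of cost \<open>O(K)\<close> per released job.
\<close>

section \<open>Weakest preconditions\<close>

\<comment> \<open>\<open>While\<close> is left out, since its inversion rule would rewrite forever;
  loops go through \<open>wp_While\<close>.\<close>
inductive_simps exec_simps:
  "exec V t Skip s k s'"
  "exec V t (Assign x e f) s k s'"
  "exec V t (RAssign x e r) s k s'"
  "exec V t (Open e) s k s'"
  "exec V t (Put e) s k s'"
  "exec V t (Alarm e) s k s'"
  "exec V t (Seq c d) s k s'"
  "exec V t (If b c d) s k s'"

text \<open>Total correctness, with the step count passed to the postcondition. Some execution is
  enough, because \<open>exec\<close> is deterministic.\<close>

definition wp :: "problem \<Rightarrow> int \<Rightarrow> com \<Rightarrow> (nat \<Rightarrow> state \<Rightarrow> bool) \<Rightarrow> state \<Rightarrow> bool" where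
  "wp V t c Q s \<longleftrightarrow> (\<exists>k s'. exec V t c s k s' \<and> Q k s')"

lemma wp_simps:
  "wp V t Skip Q s \<longleftrightarrow> Q 1 s"
  "wp V t (Assign x e f) Q s \<longleftrightarrow>
     Q 1 (s\<lparr>icells := (icells s)(x := (icells s x)(ieval V t e s := ieval V t f s))\<rparr>)"
  "wp V t (RAssign x e r) Q s \<longleftrightarrow>
     Q 1 (s\<lparr>rcells := (rcells s)(x := (rcells s x)(ieval V t e s := reval V t r s))\<rparr>)"
  "wp V t (Open e) Q s \<longleftrightarrow>
     Q 1 (s\<lparr>emitted := \<lparr>bjobs = {}, btype = nat (ieval V t e s), btime = t\<rparr> # emitted s\<rparr>)"
  "wp V t (Put e) Q s \<longleftrightarrow> Q 1 (s\<lparr>emitted := put_job (nat (ieval V t e s)) (emitted s)\<rparr>)"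
  "wp V t (Alarm e) Q s \<longleftrightarrow> Q 1 (s\<lparr>alarm := Some (ieval V t e s)\<rparr>)"
  "wp V t (Seq c d) Q s \<longleftrightarrow> wp V t c (\<lambda>k. wp V t d (\<lambda>l. Q (k + l))) s"
  "wp V t (If b c d) Q s \<longleftrightarrow>
     (if beval V t b s then wp V t c (\<lambda>k. Q (1 + k)) s else wp V t d (\<lambda>k. Q (1 + k)) s)"
  unfolding wp_def exec_simps by (auto; blast)+

lemma wp_mono: "wp V t c Q s \<Longrightarrow> (\<And>k s'. Q k s' \<Longrightarrow> R k s') \<Longrightarrow> wp V t c R s"
  unfolding wp_def by blast

text \<open>\<open>J\<close> is indexed by the exact number of iterations left; induction on it
  gives termination and the step count together. Each iteration costs a test and at most
  \<open>T\<close> steps, and the failing test costs one more.\<close>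

lemma wp_While:
  assumes "J m s"
    and step: "\<And>m s. J (Suc m) s \<Longrightarrow> beval V t b s \<and> wp V t c (\<lambda>k s'. k \<le> T \<and> J m s') s"
    and stop: "\<And>s. J 0 s \<Longrightarrow> \<not> beval V t b s"
    and post: "\<And>k s'. J 0 s' \<Longrightarrow> k \<le> 1 + m * (T + 1) \<Longrightarrow> Q k s'"
  shows "wp V t (While b c) Q s"
proof -
  have "wp V t (While b c) (\<lambda>k s'. k \<le> 1 + m * (T + 1) \<and> J 0 s') s"
    using assms(1)
  proof (induction m arbitrary: s)
    case 0
    then show ?case using stop exec.While_False unfolding wp_def by fastforce
  next
    case (Suc m)
    from step[OF Suc.prems] obtain k s' where s': "beval V t b s" "exec V t c s k s'" "k \<le> T" "J m s'"
      unfolding wp_def by blast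
    from Suc.IH[OF s'(4)] obtain l s'' where
      "exec V t (While b c) s' l s''" "l \<le> 1 + m * (T + 1)" "J 0 s''"
      unfolding wp_def by blast
    with s' exec.While_True[OF s'(1,2)] show ?case
      unfolding wp_def by (intro exI[of _ "1 + k + l"] exI[of _ s'']) auto
  qed
  then show ?thesis by (rule wp_mono) (use post in blast)
qed


section \<open>The covering knapsack table\<close>

text \<open>
  \<open>f i\<close> is the least cost of a collection of batches with total capacity at least \<open>i\<close>, and \<open>g i\<close> the
  type of one of them. Cells at nonpositive indices are never written and hold the value
  \<open>0\<close> that the recurrence needs there.
\<close>

definition row :: "problem \<Rightarrow> nat \<Rightarrow> (int \<Rightarrow> real) \<Rightarrow> (int \<Rightarrow> int) \<Rightarrow> int \<Rightarrow> bool" where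
  "row I K f g i \<longleftrightarrow>
     (\<exists>k<K. g i = int k \<and> f i = price I k + f (i - int (capacity I k))) \<and>
     (\<forall>k<K. f i \<le> price I k + f (i - int (capacity I k)))"

definition table :: "problem \<Rightarrow> (int \<Rightarrow> real) \<Rightarrow> (int \<Rightarrow> int) \<Rightarrow> nat \<Rightarrow> bool" where
  "table I f g q \<longleftrightarrow> (\<forall>i\<le>0. f i = 0) \<and> (\<forall>i. 0 < i \<longrightarrow> i \<le> int q \<longrightarrow> row I (ntypes I) f g i)"

text \<open>The recurrence only looks downwards, so writing a new top entry leaves the older ones
  correct.\<close>

lemma row_cong:
  assumes "\<And>j. j \<le> i \<Longrightarrow> f j = f' j" "g i = g' i"
  shows "row I K f g i \<longleftrightarrow> row I K f' g' i"
proof -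
  have "f (i - int c) = f' (i - int c)" for c using assms(1) by simp
  with assms show ?thesis by (simp add: row_def)
qed

lemma table_upd:
  assumes "table I f g q"
  shows "table I (f(int q + 1 := x)) (g(int q + 1 := y)) q"
proof -
  have "row I (ntypes I) (f(int q + 1 := x)) (g(int q + 1 := y)) i = row I (ntypes I) f g i"
    if "i \<le> int q" for i using that by (intro row_cong) auto
  with assms show ?thesis by (simp add: table_def)
qed

lemma table_Suc: "table I f g (Suc q) \<longleftrightarrow> table I f g q \<and> row I (ntypes I) f g (int q + 1)"
proof -
  have "i \<le> int (Suc q) \<longleftrightarrow> i \<le> int q \<or> i = int q + 1" for i by auto
  then show ?thesis unfolding table_def by (metis add_increasing2 of_nat_0_le_iff zero_le_one zle_add1_eq_le order_refl)
qed

text \<open>The argument \<open>K\<close> of \<open>row\<close> counts the types examined so far;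
  this lemma and \<open>row_new\<close> are the two branches of the loop over the types.\<close>

lemma row_keep:
  assumes "row I k f g i" "f i \<le> price I k + f (i - int (capacity I k))"
  shows "row I (Suc k) f g i"
  using assms unfolding row_def by (auto simp: less_Suc_eq)

text \<open>For \<open>k = 0\<close> nothing is assumed about the old entry, which is simply
  overwritten. As capacities are at least 1, the overwritten entry is none of those it is compared
  with.\<close>

lemma row_new:
  assumes "0 < k \<Longrightarrow> row I k f g i \<and> price I k + f (i - int (capacity I k)) \<le> f i"
    and "\<forall>l\<le>k. 1 \<le> capacity I l"
  shows "row I (Suc k) (f(i := price I k + f (i - int (capacity I k)))) (g(i := int k)) i"
proof -
  have "i - int (capacity I l) \<noteq> i" if "l \<le> k" for l using assms(2) that by fastforce
  with assms(1) show ?thesis unfolding row_def by (fastforce simp: less_Suc_eq)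
qed

text \<open>Peel off one batch: the recurrence pays for its type, and the rest covers the reduced
  index, which may become negative. This is one half of optimality; \<open>flush\<close> shows that
  the value is attained.\<close>

lemma table_le_cover:
  assumes "wf_problem I" "table I f g q" "\<forall>k\<in>set ks. k < ntypes I"
    and "i \<le> int q" "i \<le> (\<Sum>k\<leftarrow>ks. int (capacity I k))"
  shows "f i \<le> (\<Sum>k\<leftarrow>ks. price I k)"
  using assms(3-)
proof (induction ks arbitrary: i)
  case Nil
  with assms(2) show ?case by (simp add: table_def)
next
  case (Cons k ks)
  have IH: "f (i - int (capacity I k)) \<le> (\<Sum>k\<leftarrow>ks. price I k)" using Cons by simp
  show ?case
  proof (cases "0 < i")
    case True
    then have "f i \<le> price I k + f (i - int (capacity I k))"
      using assms(2) Cons.prems by (simp add: table_def row_def)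
    with IH show ?thesis by simp
  next
    case False
    have "0 \<le> price I l" if "l \<in> set (k # ks)" for l
      using assms(1) Cons.prems(1) that unfolding wf_problem_def
      by (meson order_trans zero_le_one)
    then have "0 \<le> (\<Sum>l\<leftarrow>k # ks. price I l)" by (intro sum_list_nonneg) auto
    with False assms(2) show ?thesis by (simp add: table_def)
  qed
qed


section \<open>The program\<close>

abbreviation Var :: "string \<Rightarrow> iexp" where "Var x \<equiv> Cell x (Lit 0)"

abbreviation Less :: "iexp \<Rightarrow> iexp \<Rightarrow> bexp" where "Less e f \<equiv> Neg (Le f e)"

abbreviation Incr :: "string \<Rightarrow> com" where "Incr x \<equiv> Assign x (Lit 0) (Plus (Var x) (Lit 1))"

text \<open>
  Jobs below \<open>p\<close> have been executed and jobs from \<open>p\<close> up to \<open>q\<close> are pending, with earliest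
  deadline \<open>d\<close>; \<open>r\<close> is the room left in the current batch.
\<close>

definition candidate :: rexp where
  "candidate = RPlus (Price (Var ''k'')) (RCell ''f'' (Minus (Var ''q'') (Capacity (Var ''k''))))"

text \<open>Type 0 must always be written: an unwritten cell holds 0 and would beat every
  candidate.\<close>

definition fill_body :: com where
  "fill_body =
     Seq (If (Conj (Less (Lit 0) (Var ''k'')) (RLe (RCell ''f'' (Var ''q'')) candidate))
           Skip
           (Seq (RAssign ''f'' (Var ''q'') candidate) (Assign ''g'' (Var ''q'') (Var ''k''))))
         (Incr ''k'')"

definition fill :: com where
  "fill = While (Less (Var ''k'') Num_types) fill_body"

text \<open>Jobs are numbered from 0 but table entries from 1, so the deadline is read before
  \<open>q\<close> is incremented and the entry is filled afterwards.\<close>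

definition scan_body :: com where
  "scan_body =
     Seq (If (Conj (Less (Var ''p'') (Var ''q'')) (Le (Var ''d'') (Deadline (Var ''q''))))
           Skip
           (Assign ''d'' (Lit 0) (Deadline (Var ''q''))))
     (Seq (Incr ''q'')
     (Seq (Assign ''k'' (Lit 0) (Lit 0)) fill))"

definition scan :: com where
  "scan = While (Less (Var ''q'') Num_released) scan_body"

definition flush_body :: com where
  "flush_body =
     Seq (If (Le (Var ''r'') (Lit 0))
           (Seq (Open (Cell ''g'' (Minus (Var ''q'') (Var ''p''))))
                (Assign ''r'' (Lit 0) (Capacity (Cell ''g'' (Minus (Var ''q'') (Var ''p''))))))
           Skip)
     (Seq (Put (Var ''p''))
     (Seq (Incr ''p'') (Assign ''r'' (Lit 0) (Minus (Var ''r'') (Lit 1)))))"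

text \<open>Resetting \<open>r\<close> discards room left in the last batch of an earlier round,
  which has already been executed.\<close>

definition flush :: com where
  "flush = Seq (Assign ''r'' (Lit 0) (Lit 0)) (While (Less (Var ''p'') (Var ''q'')) flush_body)"

definition flush_at_deadline :: com where
  "flush_at_deadline =
     Seq scan
       (If (Less (Var ''p'') (Var ''q''))
         (If (Le (Var ''d'') Clock) flush (Alarm (Var ''d'')))
         Skip)"

text \<open>Using \<open>memory_scheme\<close> makes the invariant apply to a running
  \<open>state\<close> and to the \<open>memory\<close> kept between invocations.\<close>

definition ready :: "problem \<Rightarrow> nat \<Rightarrow> nat \<Rightarrow> 'a memory_scheme \<Rightarrow> bool" where
  "ready I p q s \<longleftrightarrow> p \<le> q \<and> icells s ''p'' 0 = int p \<and> icells s ''q'' 0 = int q \<and>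
     (p < q \<longrightarrow> icells s ''d'' 0 = Min (deadline I ` {p..<q})) \<and>
     table I (rcells s ''f'') (icells s ''g'') q"

section \<open>Correctness and step counts of the table and scan loops\<close>

lemma fill:
  assumes wf: "wf_problem I"
    and s: "icells s ''p'' 0 = int p" "icells s ''q'' 0 = int q + 1" "icells s ''d'' 0 = d"
      "icells s ''k'' 0 = 0" "table I (rcells s ''f'') (icells s ''g'') q"
      "emitted s = E" "alarm s = a"
  shows "wp (revealed I u) u fill (\<lambda>k s'. k \<le> 1 + 5 * ntypes I \<and>
    icells s' ''p'' 0 = int p \<and> icells s' ''q'' 0 = int q + 1 \<and> icells s' ''d'' 0 = d \<and>
    table I (rcells s' ''f'') (icells s' ''g'') (Suc q) \<and> emitted s' = E \<and> alarm s' = a) s"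
proof -
  \<comment> \<open>Here \<open>m\<close> types are still to be examined; the new entry means
    something only after the first type, hence the guard \<open>m < ntypes I\<close>.\<close>
  define J where "J m s \<longleftrightarrow> m \<le> ntypes I \<and>
    icells s ''p'' 0 = int p \<and> icells s ''q'' 0 = int q + 1 \<and> icells s ''d'' 0 = d \<and>
    icells s ''k'' 0 = int (ntypes I - m) \<and> table I (rcells s ''f'') (icells s ''g'') q \<and>
    (m < ntypes I \<longrightarrow> row I (ntypes I - m) (rcells s ''f'') (icells s ''g'') (int q + 1)) \<and>
    emitted s = E \<and> alarm s = a" for m and s :: state
  show ?thesis
    unfolding fill_def
  proof (rule wp_While[where J = J and m = "ntypes I" and T = 4])
    show "J (ntypes I) s" using s by (simp add: J_def)
  next
    fix m s assume J: "J (Suc m) s"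
    define k where "k = ntypes I - Suc m"
    have k: "k < ntypes I" "ntypes I - m = Suc k" "0 < k \<longleftrightarrow> Suc m < ntypes I"
      using J unfolding J_def k_def by auto
    have cap: "\<forall>l\<le>k. 1 \<le> capacity I l" using wf k(1) by (simp add: wf_problem_def)
    note Js = J[unfolded J_def, folded k_def]
    show "beval (revealed I u) u (Less (Var ''k'') Num_types) s \<and>
        wp (revealed I u) u fill_body (\<lambda>k s'. k \<le> 4 \<and> J m s') s"
    proof (intro conjI)
      show "beval (revealed I u) u (Less (Var ''k'') Num_types) s" using Js k by simp
      show "wp (revealed I u) u fill_body (\<lambda>k s'. k \<le> 4 \<and> J m s') s"
        using Js k row_keep[of I k "rcells s ''f''" "icells s ''g''" "int q + 1"]
          row_new[OF _ cap, of "rcells s ''f''" "icells s ''g''" "int q + 1"]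
        by (auto simp: fill_body_def candidate_def wp_simps J_def table_upd)
    qed
  next
    show "\<not> beval (revealed I u) u (Less (Var ''k'') Num_types) s" if "J 0 s" for s
      using that by (simp add: J_def)
  next
    show "k \<le> 1 + 5 * ntypes I \<and>
      icells s' ''p'' 0 = int p \<and> icells s' ''q'' 0 = int q + 1 \<and> icells s' ''d'' 0 = d \<and>
      table I (rcells s' ''f'') (icells s' ''g'') (Suc q) \<and> emitted s' = E \<and> alarm s' = a"
      if "J 0 s'" "k \<le> 1 + ntypes I * (4 + 1)" for k s'
      using that wf by (auto simp: J_def table_Suc wf_problem_def)
  qed
qed

lemma Min_deadline_Suc:
  assumes "p < q"
  shows "Min (deadline I ` {p..<Suc q}) = min (Min (deadline I ` {p..<q})) (deadline I q)"
proof -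
  have "{p..<Suc q} = insert q {p..<q}" using assms by auto
  then show ?thesis using assms by (simp add: min.commute)
qed

lemma scan:
  assumes wf: "wf_problem I" and s: "ready I p q s" "emitted s = E" "alarm s = a"
    and "q \<le> q'" "q' = njobs (revealed I u)"
  shows "wp (revealed I u) u scan (\<lambda>k s'. k \<le> 1 + (q' - q) * (6 + 5 * ntypes I) \<and>
    ready I p q' s' \<and> emitted s' = E \<and> alarm s' = a) s"
proof -
  define J where "J m s \<longleftrightarrow> m \<le> q' \<and> ready I p (q' - m) s \<and> emitted s = E \<and> alarm s = a"
    for m and s :: state
  show ?thesis
    unfolding scan_def
  \<comment> \<open>Four steps precede the inner loop, which takes at most
    \<open>1 + 5 * ntypes I\<close>.\<close>
  proof (rule wp_While[where J = J and m = "q' - q" and T = "5 + 5 * ntypes I"])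
    show "J (q' - q) s" using assms by (simp add: J_def)
  next
    fix m s assume J: "J (Suc m) s"
    define i where "i = q' - Suc m"
    have i: "i < q'" "q' - m = Suc i" using J unfolding J_def i_def by auto
    note Js = J[unfolded J_def ready_def, folded i_def]
    have dl: "deadline (revealed I u) i = deadline I i" using i assms(6) by simp
    show "beval (revealed I u) u (Less (Var ''q'') Num_released) s \<and>
        wp (revealed I u) u scan_body (\<lambda>k s'. k \<le> 5 + 5 * ntypes I \<and> J m s') s"
    proof (intro conjI)
      show "beval (revealed I u) u (Less (Var ''q'') Num_released) s"
        using Js i assms(6) by simp
      define d where "d = Min (deadline I ` {p..<Suc i})"
      have d: "d = (if p < i \<and> icells s ''d'' 0 \<le> deadline I i then icells s ''d'' 0 else deadline I i)"
      proof (cases "p < i")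
        case True
        then show ?thesis using Js Min_deadline_Suc[of p i I] by (auto simp: d_def)
      next
        case False
        then have "p = i" using Js by simp
        then show ?thesis by (simp add: d_def)
      qed
      have *: "wp (revealed I u) u fill (\<lambda>k s'. 4 + k \<le> 5 + 5 * ntypes I \<and> J m s') s'"
        if "icells s' ''p'' 0 = int p" "icells s' ''q'' 0 = int i + 1" "icells s' ''d'' 0 = d"
          "icells s' ''k'' 0 = 0" "table I (rcells s' ''f'') (icells s' ''g'') i"
          "emitted s' = E" "alarm s' = a" for s'
        using fill[OF wf that, of u]
        by (rule wp_mono) (use Js i in \<open>auto simp: J_def ready_def d_def\<close>)
      show "wp (revealed I u) u scan_body (\<lambda>k s'. k \<le> 5 + 5 * ntypes I \<and> J m s') s"
        unfolding scan_body_def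
        by (simp add: wp_simps Js dl del: revealed_simps)
          (use d Js in \<open>auto intro!: *[simplified]\<close>)
    qed
  next
    show "\<not> beval (revealed I u) u (Less (Var ''q'') Num_released) s" if "J 0 s" for s
      using that assms(6) by (simp add: J_def ready_def)
  qed (use assms(5) in \<open>auto simp: J_def\<close>)
qed


section \<open>Executing all pending jobs\<close>

text \<open>A partition in list form, which grows by cons and append. Disjoint nonempty sets differ,
  so the distinctness demanded by \<open>feasible\<close> follows.\<close>

definition blocks :: "nat set \<Rightarrow> batch list \<Rightarrow> bool" where
  "blocks A S \<longleftrightarrow> (\<forall>X\<in>set S. bjobs X \<noteq> {}) \<and> \<Union> (bjobs ` set S) = A \<and>
     sorted_wrt (\<lambda>X Y. bjobs X \<inter> bjobs Y = {}) S"

lemma blocks_append: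
  assumes "blocks A S" "blocks B T" "A \<inter> B = {}"
  shows "blocks (A \<union> B) (S @ T)"
  using assms unfolding blocks_def by (auto simp: sorted_wrt_append)

lemma blocks_partition:
  assumes "blocks A S"
  shows "distinct (map bjobs S)" "partition_on A (bjobs ` set S)"
proof -
  have "distinct (map bjobs S) \<and> disjoint (bjobs ` set S)"
    if "\<forall>X\<in>set S. bjobs X \<noteq> {}" "sorted_wrt (\<lambda>X Y. bjobs X \<inter> bjobs Y = {}) S" for S
    using that
  proof (induction S)
    case (Cons X S)
    then show ?case by (force simp: disjoint_def)
  qed simp
  with assms show "distinct (map bjobs S)" "partition_on A (bjobs ` set S)"
    by (auto simp: blocks_def partition_on_def)
qed

text \<open>\<open>Open\<close> alone would create an empty block; since \<open>Put\<close> always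
  follows, the two are treated as one step.\<close>

lemma blocks_open: "blocks A S \<Longrightarrow> j \<notin> A \<Longrightarrow> blocks (insert j A) (\<lparr>bjobs = {j}, btype = k, btime = t\<rparr> # S)"
  by (auto simp: blocks_def)

lemma blocks_put: "blocks A (X # S) \<Longrightarrow> j \<notin> A \<Longrightarrow> blocks (insert j A) (X\<lparr>bjobs := insert j (bjobs X)\<rparr> # S)"
  by (auto simp: blocks_def)

definition fits :: "problem \<Rightarrow> batch \<Rightarrow> bool" where
  "fits I X \<longleftrightarrow> btype X < ntypes I \<and> card (bjobs X) \<le> capacity I (btype X)"

lemma flush:
  assumes wf: "wf_problem I"
    and s: "ready I p q s" "emitted s = []" "alarm s = a"
  shows "wp (revealed I u) u flush (\<lambda>k s'. k \<le> 2 + (q - p) * 7 \<and> ready I q q s' \<and> alarm s' = a \<and>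
    blocks {p..<q} (emitted s') \<and> (\<forall>X\<in>set (emitted s'). fits I X \<and> btime X = u) \<and>
    cost I (emitted s') = rcells s ''f'' (int (q - p))) s"
proof -
  define f g where "f = rcells s ''f''" and "g = icells s ''g''"
  have tab: "table I f g q" and pq: "p \<le> q" using s by (auto simp: ready_def f_def g_def)
  \<comment> \<open>With \<open>m\<close> jobs left and room \<open>r\<close> already paid for, only
    \<open>m - r\<close> jobs remain to be charged, so cost so far plus \<open>f (m - r)\<close>
    stays \<open>f (q - p)\<close>. At the end the index is \<open>- r\<close>, where
    \<open>f\<close> is 0.\<close>
  define J where "J m s \<longleftrightarrow> m \<le> q - p \<and> icells s ''p'' 0 = int (q - m) \<and>
    icells s ''q'' 0 = int q \<and> rcells s ''f'' = f \<and> icells s ''g'' = g \<and> alarm s = a \<and>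
    blocks {p..<q - m} (emitted s) \<and> (\<forall>X\<in>set (emitted s). fits I X \<and> btime X = u) \<and>
    (\<exists>r. icells s ''r'' 0 = int r \<and> cost I (emitted s) + f (int m - int r) = f (int (q - p)) \<and>
      (0 < r \<longrightarrow> (\<exists>X S. emitted s = X # S \<and> card (bjobs X) + r \<le> capacity I (btype X))))"
    for m and s :: state
  have "wp (revealed I u) u (While (Less (Var ''p'') (Var ''q'')) flush_body)
     (\<lambda>k s'. 1 + k \<le> 2 + (q - p) * 7 \<and> ready I q q s' \<and> alarm s' = a \<and>
    blocks {p..<q} (emitted s') \<and> (\<forall>X\<in>set (emitted s'). fits I X \<and> btime X = u) \<and>
    cost I (emitted s') = f (int (q - p))) s'" if "J (q - p) s'" for s'
    using that
  proof (rule wp_While[where J = J and m = "q - p" and T = 6])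
    fix m s assume J: "J (Suc m) s"
    define i where "i = q - Suc m"
    have i: "q - m = Suc i" "p \<le> i" "int q - int i = 1 + int m"
      using J pq unfolding J_def i_def by auto
    have ins: "insert i {p..<i} = {p..<Suc i}" using i by auto
    from J obtain r where Js: "m < q - p" "icells s ''p'' 0 = int i"
      "icells s ''q'' 0 = int q" "rcells s ''f'' = f" "icells s ''g'' = g" "alarm s = a"
      "blocks {p..<i} (emitted s)" "\<forall>X\<in>set (emitted s). fits I X \<and> btime X = u"
      and r: "icells s ''r'' 0 = int r" "cost I (emitted s) + f (int (Suc m) - int r) = f (int (q - p))"
        "0 < r \<Longrightarrow> (\<exists>X S. emitted s = X # S \<and> card (bjobs X) + r \<le> capacity I (btype X))"
      unfolding J_def i_def by auto
    show "beval (revealed I u) u (Less (Var ''p'') (Var ''q'')) s \<and>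
        wp (revealed I u) u flush_body (\<lambda>k s'. k \<le> 6 \<and> J m s') s"
    proof (intro conjI)
      show "beval (revealed I u) u (Less (Var ''p'') (Var ''q'')) s" using Js i by auto
      show "wp (revealed I u) u flush_body (\<lambda>k s'. k \<le> 6 \<and> J m s') s"
      proof (cases "r = 0")
        case True
        have "row I (ntypes I) f g (1 + int m)"
          using tab Js(1) by (auto simp: table_def)
        then obtain k where k: "k < ntypes I" "g (1 + int m) = int k"
          "f (1 + int m) = price I k + f (1 + int m - int (capacity I k))" by (auto simp: row_def)
        have "1 \<le> capacity I k" using wf k by (simp add: wf_problem_def)
        \<comment> \<open>The opened batch receives job \<open>i\<close> at once, leaving room
          \<open>c\<close>; the invariant survives as \<open>1 + m - Suc c = m - c\<close>.\<close>
        then obtain c where c: "capacity I k = Suc c" by (cases "capacity I k") auto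
        have b: "blocks {p..<Suc i} (\<lparr>bjobs = {i}, btype = k, btime = u\<rparr> # emitted s)"
          using blocks_open[OF Js(7), of i k u] ins by simp
        show ?thesis
          using True r(1,2) Js k c i b
          by (auto simp: flush_body_def wp_simps J_def fits_def cost_def intro!: exI[of _ c])
      next
        case False
        then obtain X S where X: "emitted s = X # S" "card (bjobs X) + r \<le> capacity I (btype X)"
          using r(3) by blast
        from False obtain c where c: "r = Suc c" by (cases r) auto
        have b: "blocks {p..<Suc i} (X\<lparr>bjobs := insert i (bjobs X)\<rparr> # S)"
          using blocks_put[of "{p..<i}" X S i] Js(7) X ins by simp
        \<comment> \<open>Finiteness of the job sets is not in the invariant; an infinite set has
          cardinality 0.\<close>
        have "card (insert i (bjobs X)) \<le> Suc (card (bjobs X))"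
          by (cases "finite (bjobs X)") (auto simp: card_insert_if)
        then show ?thesis
          using r(1,2) Js i b X c
          by (auto simp: flush_body_def wp_simps J_def fits_def cost_def intro!: exI[of _ c])
      qed
    qed
  next
    show "\<not> beval (revealed I u) u (Less (Var ''p'') (Var ''q'')) s" if "J 0 s" for s
      using that by (simp add: J_def)
  qed (use tab in \<open>auto simp: J_def ready_def table_def\<close>)
  moreover have "J (q - p) (s\<lparr>icells := (icells s)(''r'' := (icells s ''r'')(0 := 0))\<rparr>)"
    using s pq by (auto simp: J_def ready_def f_def g_def blocks_def cost_def intro!: exI[of _ 0])
  ultimately show ?thesis by (simp add: flush_def wp_simps f_def)
qed


section \<open>One invocation\<close>

text \<open>This is the alarm pending between two invocations.\<close>

definition next_deadline :: "problem \<Rightarrow> nat \<Rightarrow> nat \<Rightarrow> int option" where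
  "next_deadline I p q = (if p < q then Some (Min (deadline I ` {p..<q})) else None)"

definition covered_by :: "problem \<Rightarrow> nat \<Rightarrow> nat list \<Rightarrow> bool" where
  "covered_by I m ks \<longleftrightarrow> (\<forall>k\<in>set ks. k < ntypes I) \<and> m \<le> (\<Sum>k\<leftarrow>ks. capacity I k)"

text \<open>Either all pending jobs are executed (\<open>p' = q'\<close>) or none
  (\<open>p' = p\<close>). The cost is the table value in the first case and 0 in the second, so no
  cover is cheaper. The constant 5 collects the final test of \<open>scan\<close>, two tests and the
  2 of \<open>flush\<close>.\<close>

lemma invocation:
  assumes wf: "wf_problem I" and m: "ready I p q m" and q': "q \<le> q'" "q' = njobs (revealed I u)"
  obtains k s p' where
    "exec (revealed I u) u flush_at_deadline (memory.extend m \<lparr>emitted = [], alarm = None\<rparr>) k s"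
    "k \<le> 5 + (q' - q) * (6 + 5 * ntypes I) + (p' - p) * 7"
    "ready I p' q' (memory.truncate s)"
    "alarm s = next_deadline I p' q'"
    "p < q' \<and> Min (deadline I ` {p..<q'}) \<le> u \<and> p' = q' \<or>
       (p < q' \<longrightarrow> u < Min (deadline I ` {p..<q'})) \<and> p' = p"
    "blocks {p..<p'} (emitted s)"
    "\<forall>X\<in>set (emitted s). fits I X \<and> btime X = u"
    "\<And>ks. covered_by I (p' - p) ks \<Longrightarrow> cost I (emitted s) \<le> (\<Sum>k\<leftarrow>ks. price I k)"
proof -
  let ?s = "memory.extend m \<lparr>emitted = [], alarm = None\<rparr> :: state"
  let ?P = "\<lambda>k s. \<exists>p'. k \<le> 5 + (q' - q) * (6 + 5 * ntypes I) + (p' - p) * 7 \<and>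
    ready I p' q' (memory.truncate s) \<and> alarm s = next_deadline I p' q' \<and>
    (p < q' \<and> Min (deadline I ` {p..<q'}) \<le> u \<and> p' = q' \<or>
       (p < q' \<longrightarrow> u < Min (deadline I ` {p..<q'})) \<and> p' = p) \<and>
    blocks {p..<p'} (emitted s) \<and> (\<forall>X\<in>set (emitted s). fits I X \<and> btime X = u) \<and>
    (\<forall>ks. covered_by I (p' - p) ks \<longrightarrow> cost I (emitted s) \<le> (\<Sum>k\<leftarrow>ks. price I k))"
  have trunc: "ready I a b (memory.truncate s) \<longleftrightarrow> ready I a b s" for a b and s :: state
    by (simp add: ready_def memory.truncate_def)
  have nil: "cost I [] \<le> (\<Sum>k\<leftarrow>ks. price I k)" if "covered_by I c ks" for c ks
  proof -
    have "0 \<le> price I k" if "k \<in> set ks" for k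
      using wf that \<open>covered_by I c ks\<close> unfolding wf_problem_def covered_by_def
      by (meson order_trans zero_le_one)
    then show ?thesis by (auto simp: cost_def intro!: sum_list_nonneg)
  qed
  have s: "ready I p q ?s" "emitted ?s = []" "alarm ?s = None"
    using m by (simp_all add: ready_def memory.extend_def)
  have "wp (revealed I u) u flush_at_deadline ?P ?s"
    unfolding flush_at_deadline_def wp_simps(7)
  proof (rule wp_mono[OF scan[OF wf s q']], elim conjE)
    fix k and s :: state assume k: "k \<le> 1 + (q' - q) * (6 + 5 * ntypes I)"
      and r: "ready I p q' s" and e: "emitted s = []" "alarm s = None"
    have tab: "table I (rcells s ''f'') (icells s ''g'') q'" using r by (simp add: ready_def)
    have opt: "rcells s ''f'' (int (q' - p)) \<le> (\<Sum>k\<leftarrow>ks. price I k)"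
      if "covered_by I (q' - p) ks" for ks
    proof (rule table_le_cover[OF wf tab])
      have "int (q' - p) \<le> int (\<Sum>k\<leftarrow>ks. capacity I k)"
        using that by (simp add: covered_by_def)
      also have "\<dots> = (\<Sum>k\<leftarrow>ks. int (capacity I k))" by (induction ks) auto
      finally show "int (q' - p) \<le> (\<Sum>k\<leftarrow>ks. int (capacity I k))" .
    qed (use that in \<open>auto simp: covered_by_def\<close>)
    let ?rest = "If (Less (Var ''p'') (Var ''q'')) (If (Le (Var ''d'') Clock) flush (Alarm (Var ''d''))) Skip"
    consider "p < q'" "icells s ''d'' 0 \<le> u" | "p < q'" "u < icells s ''d'' 0" | "p = q'"
      using r by (fastforce simp: ready_def)
    then show "wp (revealed I u) u ?rest (\<lambda>l. ?P (k + l)) s"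
    proof cases
      case 1
      then have due: "p < q'" "Min (deadline I ` {p..<q'}) \<le> u" using r by (simp_all add: ready_def)
      then have "wp (revealed I u) u flush (\<lambda>l. ?P (k + (1 + (1 + l)))) s"
      proof (intro wp_mono[OF flush[OF wf r e]] exI[of _ q'], goal_cases)
        case (1 l s')
        then show ?case using k opt by (simp add: trunc next_deadline_def)
      qed
      moreover have "beval (revealed I u) u (Less (Var ''p'') (Var ''q'')) s"
        "beval (revealed I u) u (Le (Var ''d'') Clock) s" using 1 r by (simp_all add: ready_def)
      ultimately show ?thesis by (simp only: wp_simps if_True)
    next
      case 2
      have "?P (k + (1 + (1 + 1))) (s\<lparr>alarm := Some (icells s ''d'' 0)\<rparr>)"
      proof (intro exI[of _ p] conjI allI impI)
        show "ready I p q' (memory.truncate (s\<lparr>alarm := Some (icells s ''d'' 0)\<rparr>))"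
          using r unfolding trunc by (simp add: ready_def)
        show "p < q' \<and> Min (deadline I ` {p..<q'}) \<le> u \<and> p = q' \<or>
            (p < q' \<longrightarrow> u < Min (deadline I ` {p..<q'})) \<and> p = p"
          using 2 r by (simp add: ready_def del: Min_gr_iff)
      qed (use 2 r k e nil in \<open>auto simp: ready_def next_deadline_def blocks_def\<close>)
      moreover have "beval (revealed I u) u (Less (Var ''p'') (Var ''q'')) s"
        "\<not> beval (revealed I u) u (Le (Var ''d'') Clock) s"
        using 2 r by (simp_all add: ready_def del: Min_gr_iff)
      ultimately show ?thesis by (simp only: wp_simps if_True if_False ieval.simps)
    next
      case 3
      then have "?P (k + (1 + 1)) s"
        using r k e nil by (simp add: trunc next_deadline_def blocks_def)
      moreover have "\<not> beval (revealed I u) u (Less (Var ''p'') (Var ''q'')) s"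
        using 3 r by (simp add: ready_def)
      ultimately show ?thesis by (simp only: wp_simps if_False)
    qed
  qed
  then show thesis unfolding wp_def using that by blast
qed


section \<open>Competitiveness and running time\<close>

definition cost_after :: "problem \<Rightarrow> batch list \<Rightarrow> int \<Rightarrow> real" where
  "cost_after I S t = cost I (filter (\<lambda>X. t < btime X) S)"

text \<open>If the jobs from \<open>p\<close> on are unexecuted, the minimum, taken over future jobs
  too, is the time of the next round.\<close>

definition cost_after_deadline :: "problem \<Rightarrow> batch list \<Rightarrow> nat \<Rightarrow> real" where
  "cost_after_deadline I S p =
     (if p < njobs I then cost_after I S (Min (deadline I ` {p..<njobs I})) else 0)"

lemma cost_filter_split:
  "cost I (filter P S) + cost I (filter (\<lambda>X. \<not> P X) S) = cost I S"
  by (induction S) (auto simp: cost_def)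

lemma cost_filter_le:
  assumes "\<forall>X\<in>set S. 0 \<le> price I (btype X)"
  shows "cost I (filter P S) \<le> cost I S"
proof -
  have "0 \<le> cost I (filter (\<lambda>X. \<not> P X) S)"
    unfolding cost_def using assms by (intro sum_list_nonneg) auto
  then show ?thesis using cost_filter_split[of I P S] by simp
qed

lemma card_UN_list:
  "\<forall>X\<in>set S. finite (F X) \<Longrightarrow> card (\<Union> (F ` set S)) \<le> (\<Sum>X\<leftarrow>S. card (F X))"
proof (induction S)
  case (Cons X S)
  have "card (\<Union> (F ` set (X # S))) \<le> card (F X) + card (\<Union> (F ` set S))"
    by (simp add: card_Un_le)
  with Cons show ?case by simp
qed simp

lemma cost_feasible_nonneg:
  assumes "wf_problem I" "feasible I R"
  shows "\<forall>X\<in>set R. 0 \<le> price I (btype X)"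
  using assms unfolding wf_problem_def feasible_def by (meson order_trans zero_le_one)

text \<open>Agreeability enters here. Jobs \<open>a..<b\<close> cannot run before their release
  after \<open>s\<close>; the job attaining \<open>D\<close> is released later than all of them, so
  their deadlines are at most \<open>D\<close>. Hence the batches of \<open>R\<close> in the window
  contain them all.\<close>

lemma round_covered:
  assumes agree: "agreeable I" and R: "feasible I R"
    and b: "b \<le> njobs I" "\<forall>j\<in>{a..<b}. s < release I j \<and> release I j \<le> u"
      "\<forall>j\<in>{b..<njobs I}. u < release I j"
  defines "D \<equiv> Min (deadline I ` {b..<njobs I})"
  shows "covered_by I (b - a)
    (map btype (filter (\<lambda>X. s < btime X \<and> (b < njobs I \<longrightarrow> btime X \<le> D)) R))"
proof -
  let ?R = "filter (\<lambda>X. s < btime X \<and> (b < njobs I \<longrightarrow> btime X \<le> D)) R"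
  have part: "partition_on {..<njobs I} (bjobs ` set R)" and
    fit: "\<forall>X\<in>set R. btype X < ntypes I \<and> card (bjobs X) \<le> capacity I (btype X) \<and>
        (\<forall>j\<in>bjobs X. release I j \<le> btime X \<and> btime X \<le> deadline I j)"
    using R by (auto simp: feasible_def)
  have Un: "\<Union> (bjobs ` set R) = {..<njobs I}" using partition_onD1[OF part] by simp
  have fin: "finite (bjobs X)" if "X \<in> set R" for X
    using Un that by (intro finite_subset[of "bjobs X" "{..<njobs I}"]) auto
  have "{a..<b} \<subseteq> \<Union> (bjobs ` set ?R)"
  proof
    fix j assume j: "j \<in> {a..<b}"
    then have "j \<in> \<Union> (bjobs ` set R)" using b Un by auto
    then obtain X where X: "X \<in> set R" "j \<in> bjobs X" by blast
    have "s < btime X" using X fit b(2) j by fastforce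
    moreover have "btime X \<le> D" if "b < njobs I"
    proof -
      have "D \<in> deadline I ` {b..<njobs I}" unfolding D_def using that by (intro Min_in) auto
      then obtain i where i: "i \<in> {b..<njobs I}" "D = deadline I i" by blast
      have "release I j < release I i" using b(2,3) i(1) j by fastforce
      then have "deadline I j \<le> D" using agree i j b(1) unfolding agreeable_def by auto
      then show ?thesis using X fit by fastforce
    qed
    ultimately show "j \<in> \<Union> (bjobs ` set ?R)" using X by auto
  qed
  then have "card {a..<b} \<le> card (\<Union> (bjobs ` set ?R))" using fin by (intro card_mono) auto
  also have "\<dots> \<le> (\<Sum>X\<leftarrow>?R. card (bjobs X))" using fin by (intro card_UN_list) auto
  also have "\<dots> \<le> (\<Sum>X\<leftarrow>?R. capacity I (btype X))" using fit by (intro sum_list_mono) auto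
  finally show ?thesis using fit by (auto simp: covered_by_def comp_def)
qed

lemma round_cost:
  assumes agree: "agreeable I" and wf: "wf_problem I" and R: "feasible I R"
    and b: "b \<le> njobs I" "\<forall>j\<in>{a..<b}. s < release I j \<and> release I j \<le> u"
      "\<forall>j\<in>{b..<njobs I}. u < release I j" and "s \<le> u"
    and c: "\<And>ks. covered_by I (b - a) ks \<Longrightarrow> c \<le> (\<Sum>k\<leftarrow>ks. price I k)"
  shows "c \<le> cost_after I R s - cost_after_deadline I R b"
proof -
  define D where "D = Min (deadline I ` {b..<njobs I})"
  let ?R = "filter (\<lambda>X. s < btime X) R"
  have le: "c \<le> cost I (filter (\<lambda>X. b < njobs I \<longrightarrow> btime X \<le> D) ?R)"
    using c[OF round_covered[OF agree R b]]
    by (simp add: D_def cost_def comp_def conj_commute)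
  show ?thesis
  proof (cases "b < njobs I")
    case True
    then have "D \<in> deadline I ` {b..<njobs I}" unfolding D_def by (intro Min_in) auto
    then obtain i where i: "i \<in> {b..<njobs I}" "D = deadline I i" by blast
    then have "u < release I i" "release I i \<le> deadline I i"
      using b(3) wf by (auto simp: wf_problem_def)
    \<comment> \<open>This makes the batches after \<open>D\<close> a part of those after
      \<open>s\<close>, so the window costs exactly the difference.\<close>
    with i assms(7) have "s < D" by simp
    then have "filter (\<lambda>X. \<not> btime X \<le> D) ?R = filter (\<lambda>X. D < btime X) R"
      by (auto simp: not_le intro!: filter_cong)
    with le True cost_filter_split[of I "\<lambda>X. btime X \<le> D" ?R] show ?thesis
      by (simp add: cost_after_def cost_after_deadline_def D_def)
  next
    case False
    with le show ?thesis by (simp add: cost_after_def cost_after_deadline_def)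
  qed
qed

lemma less_njobs_revealed:
  assumes "wf_problem I"
  shows "j < njobs (revealed I t) \<longleftrightarrow> j < njobs I \<and> release I j \<le> t"
  using released_initial[OF assms, of t] by blast

section \<open>Induction over the events of a run\<close>

definition valid :: "problem \<Rightarrow> batch \<Rightarrow> bool" where
  "valid I X \<longleftrightarrow> fits I X \<and> (\<forall>j\<in>bjobs X. release I j \<le> btime X \<and> btime X \<le> deadline I j)"

text \<open>\<open>s\<close> lies before the release of every unexecuted job, and becomes the time
  of the last round. The cost bound is a potential: a round at \<open>u\<close> leading to
  \<open>p'\<close> pays at most \<open>cost_after s - cost_after_deadline p'\<close>, and
  \<open>cost_after_deadline p\<close> equals the new \<open>cost_after u\<close>, so the sum
  telescopes.\<close>

lemma flush_at_deadline_run: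
  assumes wf: "wf_problem I" and agree: "agreeable I"
    and "ready I p (njobs (revealed I t)) m"
    and "\<forall>j\<in>{p..<njobs (revealed I t)}. t < deadline I j"
    and "\<forall>j\<in>{p..<njobs I}. s < release I j" "s \<le> t"
  shows "\<exists>S k. run flush_at_deadline I t m (next_deadline I p (njobs (revealed I t))) S k \<and>
    blocks {p..<njobs I} S \<and> (\<forall>X\<in>set S. valid I X) \<and>
    (\<forall>R. feasible I R \<longrightarrow> cost I S \<le> cost_after I R s + cost_after_deadline I R p) \<and>
    k \<le> 23 * ntypes I * ((njobs I - njobs (revealed I t)) + (njobs I - p))"
  using assms(3-)
proof (induction "(njobs I - njobs (revealed I t)) + (njobs I - p)" arbitrary: p t m s rule: less_induct)
  case less
  define n where "n = njobs I"
  define q where "q = njobs (revealed I t)"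
  define a where "a = next_deadline I p q"
  note prems = less.prems[folded q_def n_def]
  note rel = less_njobs_revealed[OF wf, folded n_def]
  have K: "1 \<le> ntypes I" and rd: "release I j \<le> deadline I j" if "j < n" for j
    using wf that by (auto simp: wf_problem_def n_def)
  have q_le: "njobs (revealed I t) \<le> n" for t using rel[of n t] by (meson less_irrefl not_le)
  have pq: "p \<le> q" "p \<le> n" using prems(1) q_le[of t] by (auto simp: ready_def q_def)
  show ?case
  proof (cases "events_after I t a = {}")
    case True
    have "p = q"
    proof (rule ccontr)
      assume "p \<noteq> q"
      then have "p < q" using pq by simp
      then have "Min (deadline I ` {p..<q}) \<in> deadline I ` {p..<q}" by (intro Min_in) auto
      then have "t < Min (deadline I ` {p..<q})" using prems(2) by auto
      then have "Min (deadline I ` {p..<q}) \<in> events_after I t a"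
        using \<open>p < q\<close> by (simp add: events_after_def a_def next_deadline_def del: Min_gr_iff)
      with True show False by simp
    qed
    moreover have "q = n"
    proof (rule ccontr)
      assume "q \<noteq> n"
      then have "q < n" using q_le q_def by (simp add: order_less_le)
      then have "t < release I q" using rel[of q t] by (simp add: q_def)
      with True \<open>q < n\<close> show False by (auto simp: events_after_def n_def)
    qed
    moreover have "cost I [] \<le> cost_after I R s + cost_after_deadline I R n" if "feasible I R" for R
    proof -
      have "0 \<le> cost_after I R s"
        using cost_feasible_nonneg[OF wf that]
        by (auto simp: cost_after_def cost_def intro!: sum_list_nonneg)
      then show ?thesis by (simp add: cost_after_deadline_def n_def cost_def)
    qed
    ultimately show ?thesis using run.Done[OF True, of flush_at_deadline m]
      by (intro exI[of _ "[]"] exI[of _ 0]) (auto simp: blocks_def n_def a_def q_def)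
  next
    case False
    define u where "u = Min (events_after I t a)"
    note nxt = next_event[OF False u_def]
    define q' where "q' = njobs (revealed I u)"
    have qq': "q \<le> q'"
    proof (cases q)
      case (Suc i)
      then have "i < q'" using rel[of i t] rel[of i u] \<open>t < u\<close> unfolding q_def q'_def by auto
      with Suc show ?thesis by simp
    qed simp
    have q'n: "q' \<le> n" using q_le q'_def by simp
    obtain k st p' where inv:
      "exec (revealed I u) u flush_at_deadline (memory.extend m \<lparr>emitted = [], alarm = None\<rparr>) k st"
      "k \<le> 5 + (q' - q) * (6 + 5 * ntypes I) + (p' - p) * 7"
      "ready I p' q' (memory.truncate st)" "alarm st = next_deadline I p' q'"
      and p': "p < q' \<and> Min (deadline I ` {p..<q'}) \<le> u \<and> p' = q' \<or>
       (p < q' \<longrightarrow> u < Min (deadline I ` {p..<q'})) \<and> p' = p"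
      and em: "blocks {p..<p'} (emitted st)" "\<forall>X\<in>set (emitted st). fits I X \<and> btime X = u"
      and opt: "\<And>ks. covered_by I (p' - p) ks \<Longrightarrow> cost I (emitted st) \<le> (\<Sum>k\<leftarrow>ks. price I k)"
      using invocation[OF wf prems(1) qq' q'_def] by blast
    have p'q': "p \<le> p'" "p' \<le> q'" using p' pq qq' by auto
    have rel_u: "j < q' \<longleftrightarrow> j < n \<and> release I j \<le> u" for j using rel[of j u] by (simp add: q'_def)
    \<comment> \<open>An earlier release after \<open>t\<close> would itself have been an earlier
      event.\<close>
    have fresh: "release I j = u" if "q \<le> j" "j < q'" for j
    proof -
      have j: "j < n" "t < release I j" "release I j \<le> u"
        using that rel[of j t] rel[of j u] by (auto simp: q_def q'_def)
      then have "release I j \<in> events_after I t a" by (auto simp: events_after_def n_def)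
      then show ?thesis using nxt(2) j by fastforce
    qed
    \<comment> \<open>No deadline is missed: the alarm bounds \<open>u\<close> for old jobs, and new
      ones are released at \<open>u\<close>.\<close>
    have due: "u \<le> deadline I j" if "p \<le> j" "j < q'" for j
    proof (cases "j < q")
      case True
      then have "p < q" using that by simp
      then have "Min (deadline I ` {p..<q}) \<in> deadline I ` {p..<q}" by (intro Min_in) auto
      then have "Min (deadline I ` {p..<q}) \<in> events_after I t a"
        using prems(2) \<open>p < q\<close> by (auto simp: events_after_def a_def next_deadline_def)
      then have "u \<le> Min (deadline I ` {p..<q})" by (rule nxt(2))
      also have "\<dots> \<le> deadline I j" using True that by (intro Min_le) auto
      finally show ?thesis .
    next
      case False
      with fresh[of j] rd[of j] that q'n show ?thesis by simp
    qed
    \<comment> \<open>A release event increases \<open>q\<close>; an alarm event triggers a round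
      and increases \<open>p\<close>. This drives the induction.\<close>
    have progress: "q + p < q' + p'"
    proof -
      have "u \<in> release I ` {..<n} \<or> a = Some u"
        using nxt(1) by (simp add: events_after_def n_def)
      then show ?thesis
      proof
        assume "u \<in> release I ` {..<n}"
        then obtain j where j: "j < n" "release I j = u" by auto
        then have "j < q'" "\<not> j < q" using rel[of j u] rel[of j t] \<open>t < u\<close> by (auto simp: q_def q'_def)
        then show ?thesis using p'q' by simp
      next
        assume "a = Some u"
        then have "p < q" "Min (deadline I ` {p..<q}) = u"
          by (auto simp: a_def next_deadline_def split: if_splits)
        moreover have "Min (deadline I ` {p..<q'}) \<le> Min (deadline I ` {p..<q})"
          using \<open>p < q\<close> qq' by (intro Min_antimono) auto
        ultimately have "p < q'" "\<not> u < Min (deadline I ` {p..<q'})" using qq' by linarith+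
        then have "p' = q'" using p' by blast
        then show ?thesis using \<open>p < q\<close> qq' by simp
      qed
    qed
    define s' where "s' = (if p < p' then u else s)"
    have late: "\<forall>j\<in>{p'..<q'}. u < deadline I j"
    proof
      fix j assume j: "j \<in> {p'..<q'}"
      with p' have "p' = p" "u < Min (deadline I ` {p..<q'})" by auto
      moreover have "Min (deadline I ` {p..<q'}) \<le> deadline I j"
        using j \<open>p' = p\<close> by (intro Min_le) auto
      ultimately show "u < deadline I j" by simp
    qed
    have unreleased: "\<forall>j\<in>{q'..<n}. u < release I j"
    proof
      fix j assume "j \<in> {q'..<n}"
      then show "u < release I j" using rel_u[of j] by auto
    qed
    have s': "\<forall>j\<in>{p'..<njobs I}. s' < release I j" "s' \<le> u"
      using p' prems(3,4) \<open>t < u\<close> unreleased by (auto simp: s'_def n_def)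
    have "(n - q') + (n - p') < (n - q) + (n - p)"
      using progress p'q' pq qq' q'n by linarith
    note IH = less.hyps[OF this[unfolded n_def q_def q'_def] inv(3)[unfolded q'_def]
        late[unfolded q'_def] s', folded q'_def n_def, folded inv(4)]
    obtain S l where S: "run flush_at_deadline I u (memory.truncate st) (alarm st) S l"
      "blocks {p'..<n} S" "\<forall>X\<in>set S. valid I X"
      "\<And>R. feasible I R \<Longrightarrow> cost I S \<le> cost_after I R s' + cost_after_deadline I R p'"
      "l \<le> 23 * ntypes I * ((n - q') + (n - p'))"
      using IH by blast
    have "run flush_at_deadline I t m a (emitted st @ S) (k + l)"
      using False u_def inv(1) S(1) by (rule run.Event)
    moreover have "blocks {p..<n} (emitted st @ S)"
    proof -
      have "{p..<p'} \<union> {p'..<n} = {p..<n}" using p'q' q'n by auto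
      then show ?thesis using blocks_append[OF em(1) S(2)] by auto
    qed
    moreover have "\<forall>X\<in>set (emitted st @ S). valid I X"
    proof -
      have "valid I X" if "X \<in> set (emitted st)" for X
      proof -
        have "bjobs X \<subseteq> {p..<p'}" using em(1) that unfolding blocks_def by blast
        then have "release I j \<le> u \<and> u \<le> deadline I j" if "j \<in> bjobs X" for j
          using that p'q' rel_u[of j] due[of j] by fastforce
        then show ?thesis using em(2) that by (auto simp: valid_def)
      qed
      with S(3) show ?thesis by auto
    qed
    moreover have "cost I (emitted st @ S) \<le> cost_after I R s + cost_after_deadline I R p"
      if R: "feasible I R" for R
    proof (cases "p < p'")
      case True
      then have eq: "p' = q'" "p < q'" "Min (deadline I ` {p..<q'}) \<le> u" using p' by auto
      have "\<forall>j\<in>{p..<q'}. s < release I j \<and> release I j \<le> u"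
        using prems(3) q'n rel_u by simp
      then have "cost I (emitted st) \<le> cost_after I R s - cost_after_deadline I R q'"
        using round_cost[OF agree wf R q'n[unfolded n_def] _ unreleased[unfolded n_def]]
          opt eq(1) prems(4) \<open>t < u\<close> by auto
      \<comment> \<open>Jobs not yet released have deadlines after \<open>u\<close>, so the earliest
        deadline is already known.\<close>
      moreover have "Min (deadline I ` {p..<n}) = u"
      proof (rule antisym)
        have "Min (deadline I ` {p..<n}) \<le> Min (deadline I ` {p..<q'})"
          using eq(2) q'n by (intro Min_antimono) auto
        with eq(3) show "Min (deadline I ` {p..<n}) \<le> u" by simp
        have "u \<le> deadline I j" if "j \<in> {p..<n}" for j
        proof (cases "j < q'")
          case True
          with due[of j] that show ?thesis by simp
        next
          case False
          then have "u < release I j" using unreleased that by simp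
          with rd[of j] that show ?thesis by simp
        qed
        then show "u \<le> Min (deadline I ` {p..<n})" using eq(2) q'n by (intro Min.boundedI) auto
      qed
      then have "cost_after_deadline I R p = cost_after I R u"
        using eq(2) q'n by (simp add: cost_after_deadline_def n_def)
      ultimately show ?thesis using S(4)[OF R] True eq(1) by (simp add: s'_def cost_def)
    next
      case False
      then have "p' = p" using p'q' by simp
      then have "emitted st = []" using em(1) by (auto simp: blocks_def)
      then show ?thesis using S(4)[OF R] \<open>p' = p\<close> by (simp add: s'_def)
    qed
    \<comment> \<open>Since \<open>x >= 1\<close>, an invocation takes at most
      \<open>(18 + 5 * ntypes I) * x\<close> steps, and \<open>18 + 5 = 23\<close>.\<close>
    moreover have "k + l \<le> 23 * ntypes I * ((n - q) + (n - p))"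
    proof -
      define x where "x = (q' - q) + (p' - p)"
      have "1 \<le> x" using progress p'q' qq' unfolding x_def by linarith
      have x: "(n - q) + (n - p) = x + ((n - q') + (n - p'))"
        using p'q' pq qq' q'n unfolding x_def by linarith
      obtain K' where K': "ntypes I = Suc K'" using wf by (cases "ntypes I") (auto simp: wf_problem_def)
      have "(q' - q) * (6 + 5 * ntypes I) \<le> x * (6 + 5 * ntypes I)" "p' - p \<le> x"
        by (auto intro: mult_le_mono1 simp: x_def)
      then have "k \<le> 5 * x + x * (6 + 5 * ntypes I) + x * 7"
        using inv(2) \<open>1 \<le> x\<close> by linarith
      also have "\<dots> \<le> 23 * ntypes I * x" unfolding K' by (simp add: algebra_simps)
      finally show ?thesis using S(5) unfolding x by (simp add: distrib_left)
    qed
    ultimately show ?thesis unfolding a_def q_def n_def by blast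
  qed
qed

text \<open>Before the first release nothing is known or pending. Both terms of the potential are at
  most the cost of \<open>R\<close>, giving the factor 2; likewise the measure starts at
  \<open>2 * njobs I\<close>, giving \<open>46 = 2 * 23\<close>.\<close>

lemma flush_at_deadline_run_online:
  assumes wf: "wf_problem I" and agree: "agreeable I"
  shows "\<exists>S k. run_online flush_at_deadline I S k \<and> feasible I S \<and>
    (\<forall>R. feasible I R \<longrightarrow> cost I S \<le> 2 * cost I R) \<and> k \<le> 46 * (njobs I * ntypes I)"
proof -
  define t where "t = release I 0 - 1"
  define m :: memory where "m = \<lparr>icells = (\<lambda>_ _. 0), rcells = (\<lambda>_ _. 0)\<rparr>"
  have rel: "t < release I j" if "j < njobs I" for j
    using wf that by (force simp: wf_problem_def t_def)
  have none: "njobs (revealed I t) = 0"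
    using less_njobs_revealed[OF wf, of 0 t] by (auto simp: t_def)
  have "ready I 0 0 m" by (simp add: ready_def m_def table_def)
  with none rel obtain S k where S: "run flush_at_deadline I t m (next_deadline I 0 0) S k"
    "blocks {0..<njobs I} S" "\<forall>X\<in>set S. valid I X"
    "\<And>R. feasible I R \<Longrightarrow> cost I S \<le> cost_after I R t + cost_after_deadline I R 0"
    "k \<le> 23 * ntypes I * (njobs I + njobs I)"
    using flush_at_deadline_run[OF wf agree, of 0 t m t] by auto
  have "run_online flush_at_deadline I S k"
    using S(1) by (simp add: run_online_def t_def m_def next_deadline_def)
  moreover have "feasible I S"
    using blocks_partition[OF S(2)] S(3) by (auto simp: feasible_def valid_def fits_def lessThan_atLeast0)
  moreover have "cost I S \<le> 2 * cost I R" if R: "feasible I R" for R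
  proof -
    note nonneg = cost_feasible_nonneg[OF wf R]
    have "0 \<le> cost I R" unfolding cost_def using nonneg by (intro sum_list_nonneg) auto
    then have "cost_after_deadline I R 0 \<le> cost I R"
      using cost_filter_le[OF nonneg] by (simp add: cost_after_deadline_def cost_after_def)
    then show ?thesis
      using S(4)[OF R] cost_filter_le[OF nonneg, of "\<lambda>X. t < btime X"] by (simp add: cost_after_def)
  qed
  moreover have "k \<le> 46 * (njobs I * ntypes I)" using S(5) by (simp add: algebra_simps)
  ultimately show ?thesis by blast
qed

theorem theorem2:
  shows "\<exists>P.
    competitive_on {I. wf_problem I \<and> agreeable I} 2 P \<and>
    runs_in_O_on {I. wf_problem I \<and> agreeable I}
      (\<lambda>n K. real n * real K + real n * ln (real n)) P"
proof (intro exI conjI)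
  show "competitive_on {I. wf_problem I \<and> agreeable I} 2 flush_at_deadline"
    unfolding competitive_on_def optimal_def using flush_at_deadline_run_online by blast
  show "runs_in_O_on {I. wf_problem I \<and> agreeable I}
      (\<lambda>n K. real n * real K + real n * ln (real n)) flush_at_deadline"
    unfolding runs_in_O_on_def
  proof (intro exI[of _ 46] ballI allI impI)
    fix I S k
    assume I: "I \<in> {I. wf_problem I \<and> agreeable I}" and n: "1 \<le> njobs I"
      and "run_online flush_at_deadline I S k"
    then have "k \<le> 46 * (njobs I * ntypes I)"
      \<comment> \<open>By determinism, the run with the bounded step count is the only one.\<close>
      using flush_at_deadline_run_online[of I] run_deterministic unfolding run_online_def by blast
    then have "real k \<le> 46 * (real (njobs I) * real (ntypes I))"
      by (metis of_nat_le_iff of_nat_mult of_nat_numeral)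
    moreover have "0 \<le> real (njobs I) * ln (real (njobs I))" using n by simp
    ultimately show "real k \<le> 46 * (real (njobs I) * real (ntypes I) + real (njobs I) * ln (real (njobs I)))"
      by simp
  qed
qed

end
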